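(* The error in shifted sequential summation of real numbers $x_1,\ldots,x_n$ with shift $c$ equals $$e_n=\hat{s}_n-s_n=\sum_{k=2}^{n+1}t_k\delta_k\prod_{\ell=k+1}^{n+1}(1+\delta_\ell)+\sum_{k=1}^{n+1}y_k\epsilon_k\prod_{\ell=k}^{n+1}(1+\delta_\ell).$$
   Context: Let $x_1,\ldots,x_n$ and $c$ be real numbers and $0<u<1$ the unit roundoff. Shifted sequential summation in exact arithmetic is: $y_k=x_k-c$ for $1\le k\le n$, $y_{n+1}=nc$, $t_1=y_1$, $t_k=t_{k-1}+y_k$ for $2\le k\le n+1$, with output $s_n=t_{n+1}=t_n+nc=\sum_{k=1}^n x_k$. In floating point arithmetic, with centering errors $\epsilon_k$ and summation errors $\delta_k$ satisfying $|\epsilon_k|,|\delta_k|\le u$, $$\hat{t}_1=y_1(1+\epsilon_1)(1+\delta_1),\quad\delta_1=0,\qquad \hat{t}_k=\bigl(\hat{t}_{k-1}+y_k(1+\epsilon_k)\bigr)(1+\delta_k),\quad 2\le k\le n+1,$$ and the computed sum is $\hat{s}_n=\hat{t}_{n+1}$. Empty products equal $1$. *)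

theory Defs
  imports Complex_Main
begin

(* Sequences are functions on nat, used only at the indices 1, ..., n+1 (the data x only at
   1, ..., n). Values at index 0 are dummies. *)

definition shifted_term :: "(nat \<Rightarrow> real) \<Rightarrow> real \<Rightarrow> nat \<Rightarrow> nat \<Rightarrow> real" where
  "shifted_term x c n k = (if k \<le> n then x k - c else real n * c)"

fun partial_sum :: "(nat \<Rightarrow> real) \<Rightarrow> nat \<Rightarrow> real" where
  "partial_sum y 0 = 0"
| "partial_sum y (Suc 0) = y 1"
| "partial_sum y (Suc (Suc k)) = partial_sum y (Suc k) + y (Suc (Suc k))"

fun fl_partial_sum ::
  "(nat \<Rightarrow> real) \<Rightarrow> (nat \<Rightarrow> real) \<Rightarrow> (nat \<Rightarrow> real) \<Rightarrow> nat \<Rightarrow> real" where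
  "fl_partial_sum y \<epsilon> \<delta> 0 = 0"
| "fl_partial_sum y \<epsilon> \<delta> (Suc 0) = y 1 * (1 + \<epsilon> 1) * (1 + \<delta> 1)"
| "fl_partial_sum y \<epsilon> \<delta> (Suc (Suc k)) =
     (fl_partial_sum y \<epsilon> \<delta> (Suc k) + y (Suc (Suc k)) * (1 + \<epsilon> (Suc (Suc k))))
       * (1 + \<delta> (Suc (Suc k)))"

definition shifted_sum :: "(nat \<Rightarrow> real) \<Rightarrow> real \<Rightarrow> nat \<Rightarrow> real" where
  "shifted_sum x c n = partial_sum (shifted_term x c n) (n + 1)"

definition fl_shifted_sum ::
  "(nat \<Rightarrow> real) \<Rightarrow> real \<Rightarrow> nat \<Rightarrow> (nat \<Rightarrow> real) \<Rightarrow> (nat \<Rightarrow> real) \<Rightarrow> real" where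
  "fl_shifted_sum x c n \<epsilon> \<delta> = fl_partial_sum (shifted_term x c n) \<epsilon> \<delta> (n + 1)"

lemma partial_sum_eq_sum: "partial_sum y k = (\<Sum>j=1..k. y j)"
  by (induction y k rule: partial_sum.induct) auto

lemma shifted_sum_eq_sum: "shifted_sum x c n = (\<Sum>k=1..n. x k)"
proof -
  have "(\<Sum>j=1..n. shifted_term x c n j) = (\<Sum>j=1..n. x j - c)"
    by (rule sum.cong) (auto simp: shifted_term_def)
  then show ?thesis
    by (simp add: shifted_sum_def partial_sum_eq_sum shifted_term_def sum_subtractf)
qed

end

theory Submission
  imports Defs
begin

text \<open>
  Write \<open>E k\<close> for the error of the \<open>k\<close>-th computed partial sum. One rounded addition
  adds the fresh centering error \<open>y k * \<epsilon> k\<close> to the error inherited from the previous step,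
  and the rounding factor then amplifies the total and contributes \<open>t k * \<delta> k\<close> for the exact value
  being rounded: \<open>E k = (E (k - 1) + y k * \<epsilon> k) * (1 + \<delta> k) + t k * \<delta> k\<close>.
  Each local error is thus multiplied by all later factors \<open>1 + \<delta> l\<close>; a summation error starts
  to be amplified one step later than a centering error, since it is committed only in the rounding
  of step \<open>k\<close> itself. Unrolling this linear recurrence by induction, from \<open>E 1 = y 1 * \<epsilon> 1\<close>
  (which uses \<open>\<delta> 1 = 0\<close>), gives an expansion valid for arbitrary summands, and the theorem is
  its instance for the shifted data followed by the correction term \<open>n * c\<close>.
\<close>

text \<open>
  This is what a weighted sum of local errors does in one step of the recurrence: the old terms
  all pick up the new factor. The start \<open>b k\<close> of the products is a parameter to cover both kinds of
  error, with \<open>b k = k + 1\<close> and \<open>b k = k\<close>.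
\<close>
lemma sum_mult_tail_prod_Suc:
  fixes f g :: "nat \<Rightarrow> 'a::comm_semiring_1"
  assumes "a \<le> Suc m" and b: "\<And>k. k \<le> m \<Longrightarrow> b k \<le> Suc m"
  shows "(\<Sum>k=a..Suc m. f k * (\<Prod>l=b k..Suc m. g l)) =
    (\<Sum>k=a..m. f k * (\<Prod>l=b k..m. g l)) * g (Suc m)
    + f (Suc m) * (\<Prod>l=b (Suc m)..Suc m. g l)"
proof -
  have "(\<Sum>k=a..m. f k * (\<Prod>l=b k..Suc m. g l)) =
      (\<Sum>k=a..m. f k * (\<Prod>l=b k..m. g l) * g (Suc m))"
    by (rule sum.cong) (simp_all add: b[THEN leD] mult_ac)
  then show ?thesis
    using assms(1) by (simp add: sum.nat_ivl_Suc' sum_distrib_right add.commute)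
qed

lemma fl_partial_sum_error_step:
  "fl_partial_sum y \<epsilon> \<delta> (Suc (Suc m)) - partial_sum y (Suc (Suc m)) =
    (fl_partial_sum y \<epsilon> \<delta> (Suc m) - partial_sum y (Suc m)
      + y (Suc (Suc m)) * \<epsilon> (Suc (Suc m))) * (1 + \<delta> (Suc (Suc m)))
    + partial_sum y (Suc (Suc m)) * \<delta> (Suc (Suc m))"
  by (simp add: algebra_simps)

lemma fl_partial_sum_error:
  assumes "\<delta> 1 = 0"
  shows "fl_partial_sum y \<epsilon> \<delta> (Suc m) - partial_sum y (Suc m) =
    (\<Sum>k=2..Suc m. partial_sum y k * \<delta> k * (\<Prod>l=k+1..Suc m. 1 + \<delta> l))
    + (\<Sum>k=1..Suc m. y k * \<epsilon> k * (\<Prod>l=k..Suc m. 1 + \<delta> l))"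
proof (induction m)
  case 0
  then show ?case
    using assms by (simp add: algebra_simps)
next
  case (Suc m)
  let ?M = "Suc (Suc m)"
  have summation: "(\<Sum>k=2..?M. partial_sum y k * \<delta> k * (\<Prod>l=k+1..?M. 1 + \<delta> l)) =
      (\<Sum>k=2..Suc m. partial_sum y k * \<delta> k * (\<Prod>l=k+1..Suc m. 1 + \<delta> l)) * (1 + \<delta> ?M)
      + partial_sum y ?M * \<delta> ?M"
    by (subst sum_mult_tail_prod_Suc) auto
  have centering: "(\<Sum>k=1..?M. y k * \<epsilon> k * (\<Prod>l=k..?M. 1 + \<delta> l)) =
      (\<Sum>k=1..Suc m. y k * \<epsilon> k * (\<Prod>l=k..Suc m. 1 + \<delta> l)) * (1 + \<delta> ?M)
      + y ?M * \<epsilon> ?M * (1 + \<delta> ?M)"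
    by (subst sum_mult_tail_prod_Suc) auto
  show ?case
    unfolding fl_partial_sum_error_step Suc.IH summation centering
    by (simp only: distrib_right add_ac)
qed

theorem mainTheorem9:
  fixes x \<epsilon> \<delta> y t :: "nat \<Rightarrow> real" and c u :: real and n :: nat
  assumes "n \<ge> 1"
    and "0 < u" and "u < 1"
    and "\<And>k. k \<in> {1..n+1} \<Longrightarrow> \<bar>\<epsilon> k\<bar> \<le> u"
    and "\<And>k. k \<in> {1..n+1} \<Longrightarrow> \<bar>\<delta> k\<bar> \<le> u"
    and "\<delta> 1 = 0"
  defines "y \<equiv> shifted_term x c n"
    and "t \<equiv> partial_sum y"
  shows "fl_shifted_sum x c n \<epsilon> \<delta> - shifted_sum x c n =
    (\<Sum>k=2..n+1. t k * \<delta> k * (\<Prod>l=k+1..n+1. 1 + \<delta> l))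
    + (\<Sum>k=1..n+1. y k * \<epsilon> k * (\<Prod>l=k..n+1. 1 + \<delta> l))"
  using fl_partial_sum_error[of \<delta> y \<epsilon> n] \<open>\<delta> 1 = 0\<close>
  by (simp add: fl_shifted_sum_def shifted_sum_def y_def t_def)

end
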